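(* Let $G$ be a group, $H$ a subgroup of finite index $[G:H]$ in $G$, and $K$ a normal subgroup of $H$. Let $C$ be a proper subset of $H$ (i.e. $H\setminus C\neq\emptyset$) such that $C$ is a union of right cosets $Kx$ ($x\in H$) and $H\setminus C$ is a union of finitely many right cosets of $K$. Assume that the number of right cosets of $K$ contained in $C$ is greater than $2[G:H]$ times the number of right cosets of $K$ contained in $H\setminus C$. Let $E$ be a finite subset of $C$ and $F$ a subset of $H\setminus C$. Suppose that (1) there is some right coset of $K$ contained in $H\setminus C$ which does not intersect $F$, and (2) the number of elements of $K$ is greater than $2([G:H]+1)|E|$. Then $(C\setminus E)\cup F$ is not a minimal complement in $G$.
   Context: For nonempty subsets $A,B$ of a group $G$, write $A\cdot B=\{ab: a\in A, b\in B\}$. $A$ is a left complement to $B$ if $A\cdot B=G$, and a right complement to $B$ if $B\cdot A=G$. $A$ is a minimal left (resp. right) complement to $B$ if $A$ is a left (resp. right) complement to $B$ and no proper subset of $A$ is a left (resp. right) complement to $B$. A subset $A$ of $G$ is a minimal complement in $G$ if it is a minimal left complement or a minimal right complement to some nonempty subset of $G$. *)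

theory Defs
  imports "HOL-Algebra.Coset" "HOL-Library.Extended_Nat"
begin

definition left_complement :: "('a, 'b) monoid_scheme \<Rightarrow> 'a set \<Rightarrow> 'a set \<Rightarrow> bool" where
  "left_complement G A B \<longleftrightarrow>
     A \<subseteq> carrier G \<and> A \<noteq> {} \<and> B \<subseteq> carrier G \<and> B \<noteq> {} \<and> A <#>\<^bsub>G\<^esub> B = carrier G"

definition right_complement :: "('a, 'b) monoid_scheme \<Rightarrow> 'a set \<Rightarrow> 'a set \<Rightarrow> bool" where
  "right_complement G A B \<longleftrightarrow>
     A \<subseteq> carrier G \<and> A \<noteq> {} \<and> B \<subseteq> carrier G \<and> B \<noteq> {} \<and> B <#>\<^bsub>G\<^esub> A = carrier G"

definition minimal_left_complement :: "('a, 'b) monoid_scheme \<Rightarrow> 'a set \<Rightarrow> 'a set \<Rightarrow> bool" where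
  "minimal_left_complement G A B \<longleftrightarrow>
     left_complement G A B \<and> (\<forall>A'. A' \<subset> A \<longrightarrow> \<not> left_complement G A' B)"

definition minimal_right_complement :: "('a, 'b) monoid_scheme \<Rightarrow> 'a set \<Rightarrow> 'a set \<Rightarrow> bool" where
  "minimal_right_complement G A B \<longleftrightarrow>
     right_complement G A B \<and> (\<forall>A'. A' \<subset> A \<longrightarrow> \<not> right_complement G A' B)"

definition minimal_complement :: "('a, 'b) monoid_scheme \<Rightarrow> 'a set \<Rightarrow> bool" where
  "minimal_complement G A \<longleftrightarrow>
     (\<exists>B. minimal_left_complement G A B \<or> minimal_right_complement G A B)"

text \<open>The library's \<^const>\<open>card\<close> sends infinite sets to 0. The subgroup \<open>K\<close> and the family of
  cosets contained in \<open>C\<close> may be infinite, so they are counted in \<^typ>\<open>enat\<close>.\<close>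

definition ecard :: "'a set \<Rightarrow> enat" where
  "ecard A = (if finite A then enat (card A) else \<infinity>)"

text \<open>Right cosets \<open>Kx\<close> with \<open>x \<in> H\<close>, i.e. the right cosets of \<open>K\<close> in the subgroup \<open>H\<close>.\<close>

abbreviation rcosets_in :: "('a, 'b) monoid_scheme \<Rightarrow> 'a set \<Rightarrow> 'a set \<Rightarrow> 'a set set" where
  "rcosets_in G H K \<equiv> rcosets\<^bsub>G\<lparr>carrier := H\<rparr>\<^esub> K"

text \<open>The number of right cosets of \<open>H\<close>; it is the index only when there are finitely many.\<close>

abbreviation subgroup_index :: "('a, 'b) monoid_scheme \<Rightarrow> 'a set \<Rightarrow> nat" where
  "subgroup_index G H \<equiv> card (rcosets\<^bsub>G\<^esub> H)"

end

theory Submission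
  imports Defs
begin

text \<open>Let \<open>M = (C - E) \<union> F\<close> be a minimal left complement to \<open>B\<close>; the right case follows by inversion,
  which permutes the cosets of \<open>K\<close> in \<open>H\<close> since \<open>K\<close> is normal. By minimality each \<open>m \<in> M\<close> has a
  product \<open>g m = m b(m)\<close> with no representation using another element of \<open>M\<close>. As \<open>M \<noteq> H\<close>, the set
  \<open>B\<close> has two elements in every right coset of \<open>H\<close>; collect them in \<open>S\<close>. One of the two elements of
  \<open>S\<close> in the coset of \<open>g m\<close> differs from \<open>b(m)\<close>, so \<open>g m \<in> (H - M) S\<close>. Hence, up to at most
  \<open>2 [G:H] |E|\<close> exceptions in \<open>E S\<close>, every \<open>g m\<close> lies in one of fewer right cosets of \<open>K\<close> than \<open>C\<close>
  contains. If \<open>m\<close> and \<open>m'\<close> lie in different cosets of \<open>K\<close> inside \<open>C\<close> but \<open>K g m = K g m'\<close>, then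
  \<open>g m b(m')\<^sup>-\<^sup>1 \<in> K m' \<subseteq> C\<close> is not in \<open>M\<close>, so \<open>g m \<in> E b(m')\<close>. Such collisions are therefore too few
  for the pigeonhole principle.\<close>

section \<open>Finite counting\<close>

text \<open>A target hit by two colours has at most \<open>2 e\<close> preimages. Discarding the one-colour targets
  together with their colours leaves more colours than targets, hence too many elements.\<close>

lemma colour_target_pigeonhole:
  fixes c :: "'m \<Rightarrow> 'x" and d :: "'m \<Rightarrow> 'y" and e :: nat
  assumes fin: "finite X" "finite Y" "finite P"
    and d: "d ` P \<subseteq> Y"
    and less: "card Y < card X"
    and few: "\<And>m'. m' \<in> P \<Longrightarrow> card {m \<in> P. d m = d m' \<and> c m \<noteq> c m'} \<le> e"
    and many: "\<And>Z. Z \<subseteq> X \<Longrightarrow> Z \<noteq> {} \<Longrightarrow> 2 * e * card Z < card {m \<in> P. c m \<in> Z} + 2 * e"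
  shows False
proof -
  \<comment> \<open>\<open>pure\<close> marks the elements whose target receives a single colour;
    \<open>Y1\<close> and \<open>X1\<close> collect the targets and colours of these
    elements.\<close>
  define pure where "pure m \<longleftrightarrow> (\<forall>m'\<in>P. d m' = d m \<longrightarrow> c m' = c m)" for m
  define Y1 where "Y1 = d ` {m \<in> P. pure m}"
  define X1 where "X1 = c ` {m \<in> P. pure m}"
  have Y1: "Y1 \<subseteq> Y" using d by (auto simp: Y1_def)
  have "\<exists>x. \<forall>m\<in>P. d m = y \<longrightarrow> c m = x" if "y \<in> Y1" for y
    using that unfolding Y1_def pure_def by blast
  \<comment> \<open>\<open>f\<close> reads off the only colour at a target in \<open>Y1\<close>, so
    discarding \<open>X1\<close> and \<open>Y1\<close> costs at most as many colours as
    targets.\<close>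
  then obtain f where f: "\<And>m. m \<in> P \<Longrightarrow> d m \<in> Y1 \<Longrightarrow> c m = f (d m)" by metis
  have "X1 \<subseteq> f ` Y1"
  proof
    fix x assume "x \<in> X1"
    then obtain m where "m \<in> P" "pure m" "x = c m" by (auto simp: X1_def)
    then show "x \<in> f ` Y1" using f[of m] by (auto simp: Y1_def)
  qed
  moreover have "finite Y1" using Y1 fin(2) finite_subset by blast
  ultimately have cX1: "card X1 \<le> card Y1" by (meson surj_card_le)
  have finX1: "finite X1" using fin(3) by (simp add: X1_def)
  define Z where "Z = X - X1"
  have "card X - card X1 \<le> card Z" unfolding Z_def using finX1 by (rule diff_card_le_card_Diff)
  moreover have "card (Y - Y1) = card Y - card Y1"
    using Y1 \<open>finite Y1\<close> by (simp add: card_Diff_subset)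
  moreover have "card Y1 \<le> card Y" using Y1 fin(2) by (simp add: card_mono)
  ultimately have YZ: "card (Y - Y1) < card Z" using cX1 less by linarith
  \<comment> \<open>An impure target carries \<open>m\<close> and \<open>m'\<close> of different
    colours. Every element of the fibre differs in colour from at least one of them, so
    \<open>few\<close> applies twice.\<close>
  have fibre: "card {m \<in> P. d m = y} \<le> 2 * e" if "y \<in> Y - Y1" for y
  proof (cases "\<exists>m\<in>P. d m = y")
    case True
    then obtain m where m: "m \<in> P" "d m = y" by blast
    with that have "\<not> pure m" by (auto simp: Y1_def)
    then obtain m' where m': "m' \<in> P" "d m' = d m" "c m' \<noteq> c m" by (auto simp: pure_def)
    have "{n \<in> P. d n = y} \<subseteq> {n \<in> P. d n = d m \<and> c n \<noteq> c m} \<union> {n \<in> P. d n = d m' \<and> c n \<noteq> c m'}"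
      using m m' by auto
    then have "card {n \<in> P. d n = y} \<le>
        card ({n \<in> P. d n = d m \<and> c n \<noteq> c m} \<union> {n \<in> P. d n = d m' \<and> c n \<noteq> c m'})"
      using fin(3) by (intro card_mono) auto
    also have "\<dots> \<le> e + e"
      using few[OF m(1)] few[OF m'(1)] by (meson add_mono card_Un_le le_trans)
    finally show ?thesis by simp
  next
    case False
    then have "{m \<in> P. d m = y} = {}" by auto
    then show ?thesis by (metis card.empty le0)
  qed
  have "{m \<in> P. c m \<in> Z} \<subseteq> (\<Union>y\<in>Y - Y1. {m \<in> P. d m = y})"
  proof
    fix m assume m: "m \<in> {m \<in> P. c m \<in> Z}"
    have "d m \<notin> Y1"
    proof
      assume "d m \<in> Y1"
      then obtain n where n: "n \<in> P" "pure n" "d m = d n" by (auto simp: Y1_def)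
      then have "c m = c n" using m unfolding pure_def by blast
      then show False using m n by (auto simp: Z_def X1_def)
    qed
    then show "m \<in> (\<Union>y\<in>Y - Y1. {m \<in> P. d m = y})" using m d by auto
  qed
  then have "card {m \<in> P. c m \<in> Z} \<le> card (\<Union>y\<in>Y - Y1. {m \<in> P. d m = y})"
    using fin by (intro card_mono) auto
  also have "\<dots> \<le> (\<Sum>y\<in>Y - Y1. card {m \<in> P. d m = y})" using fin by (intro card_UN_le) auto
  also have "\<dots> \<le> card (Y - Y1) * (2 * e)" using fibre by (metis (no_types, lifting) of_nat_id sum_bounded_above)
  \<comment> \<open>Fewer targets than colours remain; the one fibre saved is the slack
    \<open>2 * e\<close> allowed in \<open>many\<close>.\<close>
  also have "\<dots> \<le> (card Z - 1) * (2 * e)" using YZ by (intro mult_right_mono) auto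
  finally have "card {m \<in> P. c m \<in> Z} + 2 * e \<le> 2 * e * card Z"
    using YZ by (cases "card Z") (auto simp: algebra_simps)
  moreover have "Z \<subseteq> X" by (auto simp: Z_def)
  moreover have "Z \<noteq> {}" using YZ by auto
  ultimately show False using many[of Z] by simp
qed

lemma exists_subset_card:
  assumes "infinite A \<or> k \<le> card A"
  shows "\<exists>Q\<subseteq>A. card Q = k \<and> finite Q"
  using assms infinite_arbitrarily_large[of A k] obtain_subset_with_card_n[of k A] by metis

section \<open>Minimal left complements in a group\<close>

context group
begin

text \<open>Deleting \<open>m\<close> must leave some group element uncovered. That element is a
  product with first factor \<open>m\<close>, and no other element of \<open>M\<close> can produce
  it.\<close>

lemma minimal_left_complement_unique_product:
  assumes min: "minimal_left_complement G M B" and "m \<in> M"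
  obtains b where "b \<in> B" "\<And>m' b'. m' \<in> M \<Longrightarrow> b' \<in> B \<Longrightarrow> m' \<otimes> b' = m \<otimes> b \<Longrightarrow> m' = m"
proof (cases "M = {m}")
  \<comment> \<open>The definition already rejects the empty set left by deleting \<open>m\<close>,
    so minimality says nothing about products here; with a single element, uniqueness holds for any
    \<open>b\<close> in \<open>B\<close>.\<close>
  case True
  then show ?thesis
    using min that by (auto simp: minimal_left_complement_def left_complement_def)
next
  case False
  have lc: "left_complement G M B" and "\<not> left_complement G (M - {m}) B"
    using min \<open>m \<in> M\<close> by (auto simp: minimal_left_complement_def)
  then have "(M - {m}) <#> B \<noteq> carrier G"
    using False \<open>m \<in> M\<close> by (auto simp: left_complement_def)
  moreover have "(M - {m}) <#> B \<subseteq> carrier G"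
    using lc by (auto simp: left_complement_def set_mult_def)
  ultimately obtain g where g: "g \<in> M <#> B" "g \<notin> (M - {m}) <#> B"
    using lc by (auto simp: left_complement_def)
  then obtain m0 b where "m0 \<in> M" "b \<in> B" "g = m0 \<otimes> b" by (auto simp: set_mult_def)
  moreover have "m0 = m" using g calculation by (auto simp: set_mult_def)
  ultimately have "b \<in> B" "g = m \<otimes> b" by auto
  moreover have "m' = m" if "m' \<in> M" "b' \<in> B" "m' \<otimes> b' = m \<otimes> b" for m' b'
    using g(2) that \<open>g = m \<otimes> b\<close> unfolding set_mult_def by blast
  ultimately show ?thesis using that by blast
qed

text \<open>Since \<open>M\<close> lies in \<open>H\<close>, elements of \<open>D\<close> are
  covered only through \<open>B \<inter> D\<close>. If \<open>b\<close> lies there and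
  \<open>h\<close> is in \<open>H\<close> but not in \<open>M\<close>, covering
  \<open>h \<otimes> b\<close> forces a second element.\<close>

lemma left_complement_coset_two:
  assumes H: "subgroup H G" and lc: "left_complement G M B" and M: "M \<subset> H"
    and D: "D \<in> rcosets H"
  obtains S where "S \<subseteq> B \<inter> D" "card S = 2"
proof -
  interpret H: subgroup H G by (rule H)
  obtain h where h: "h \<in> H" "h \<notin> M" using M by auto
  obtain a where a: "a \<in> carrier G" "D = H #> a" using D by (auto simp: RCOSETS_def)
  have decomp: "\<exists>m\<in>M. \<exists>b\<in>B \<inter> D. g = m \<otimes> b" if "g \<in> D" for g
  proof -
    have gG: "g \<in> carrier G" using that a H.subset r_coset_subset_G by blast
    then obtain m b where mb: "m \<in> M" "b \<in> B" "g = m \<otimes> b"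
      using lc unfolding left_complement_def set_mult_def by blast
    have mH: "m \<in> H" and bG: "b \<in> carrier G" using mb M lc by (auto simp: left_complement_def)
    have b: "b = inv m \<otimes> g" using mb(3) mH bG by (simp add: m_assoc[symmetric])
    have "\<exists>k\<in>H. g = k \<otimes> a" using that a(2) by (simp add: r_coset_def)
    then obtain k where k: "k \<in> H" "g = k \<otimes> a" by metis
    have "b = (inv m \<otimes> k) \<otimes> a" unfolding b k(2) using k(1) mH a(1) by (simp add: m_assoc)
    moreover have "inv m \<otimes> k \<in> H" using mH k(1) by simp
    ultimately have "b \<in> D" using a(2) by (auto simp: r_coset_def)
    with mb show ?thesis by auto
  qed
  have "a \<in> D" using a H rcos_self by simp
  then obtain b where b: "b \<in> B \<inter> D" using decomp by blast
  have bG: "b \<in> carrier G" using b lc by (auto simp: left_complement_def)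
  have "\<exists>k\<in>H. b = k \<otimes> a" using b a(2) by (simp add: r_coset_def)
  then obtain k where k: "k \<in> H" "b = k \<otimes> a" by metis
  have "h \<otimes> b = (h \<otimes> k) \<otimes> a" using k h(1) a(1) by (simp add: m_assoc)
  moreover have "h \<otimes> k \<in> H" using h(1) k(1) by simp
  ultimately have "h \<otimes> b \<in> D" using a(2) by (auto simp: r_coset_def)
  then obtain m b' where mb: "m \<in> M" "b' \<in> B \<inter> D" "h \<otimes> b = m \<otimes> b'" using decomp by blast
  have "b' \<noteq> b"
    using mb h bG M H.mem_carrier by (metis psubsetD right_cancel)
  then show ?thesis using that[of "{b, b'}"] b mb by auto
qed

section \<open>The left-handed case\<close>

text \<open>The data enter only through coset families \<open>X\<close> and \<open>T\<close>, with
  \<open>E\<close> absorbing the finitely many exceptions. In this form the result applies to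
  \<open>M\<close> and to its image under inversion.\<close>

lemma not_minimal_left_complement:
  assumes H: "subgroup H G" and finH: "finite (rcosets H)" and K: "subgroup K G"
    and M: "M \<subset> H"
    and X: "finite X" "X \<subseteq> rcosets K"
    and T: "finite T" "T \<subseteq> rcosets K"
    and E: "finite E" "E \<subseteq> carrier G" "\<Union>X - M \<subseteq> E" "H - M \<subseteq> \<Union>T \<union> E"
    and XH: "\<Union>X \<subseteq> H"
    and less: "2 * card (rcosets H) * card T < card X"
    and cK: "infinite K \<or> 2 * (card (rcosets H) + 1) * card E < card K"
  shows "\<not> minimal_left_complement G M B"
proof
  assume min: "minimal_left_complement G M B"
  interpret H: subgroup H G by (rule H)
  interpret K: subgroup K G by (rule K)
  define n where "n = card (rcosets H)"
  define e where "e = card E"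
  have lc: "left_complement G M B" using min by (simp add: minimal_left_complement_def)
  have BG: "B \<subseteq> carrier G" and MG: "M \<subseteq> carrier G" using lc by (auto simp: left_complement_def)
  have "\<forall>D\<in>rcosets H. \<exists>S. S \<subseteq> B \<inter> D \<and> card S = 2"
    using left_complement_coset_two[OF H lc M] by metis
  then obtain s where s: "\<And>D. D \<in> rcosets H \<Longrightarrow> s D \<subseteq> B \<inter> D \<and> card (s D) = 2" by metis
  \<comment> \<open>Two elements per coset guarantee one different from any given
    \<open>b m\<close>; this is the source of the factor \<open>2 * n\<close>.\<close>
  define S where "S = (\<Union>D\<in>rcosets H. s D)"
  have finS: "finite S" unfolding S_def using finH s
    by (intro finite_UN_I) (auto intro: card_ge_0_finite)
  have "card S \<le> (\<Sum>D\<in>rcosets H. card (s D))" unfolding S_def using finH by (rule card_UN_le)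
  also have "\<dots> = 2 * n" using s by (simp add: n_def)
  finally have cS: "card S \<le> 2 * n" .
  have SB: "S \<subseteq> B" using s by (auto simp: S_def)
  have "\<forall>m\<in>M. \<exists>b\<in>B. \<forall>m'\<in>M. \<forall>b'\<in>B. m' \<otimes> b' = m \<otimes> b \<longrightarrow> m' = m"
    using minimal_left_complement_unique_product[OF min] by metis
  then obtain b where bB: "\<And>m. m \<in> M \<Longrightarrow> b m \<in> B"
    and uniq: "\<And>m m' b'. m \<in> M \<Longrightarrow> m' \<in> M \<Longrightarrow> b' \<in> B \<Longrightarrow> m' \<otimes> b' = m \<otimes> b m \<Longrightarrow> m' = m"
    by metis
  define g where "g m = m \<otimes> b m" for m
  have gG: "g m \<in> carrier G" if "m \<in> M" for m
    using that bB MG BG by (auto simp: g_def)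
  have inj_g: "inj_on g M" unfolding inj_on_def g_def using uniq bB by metis
  \<comment> \<open>Minimality in the form used below: dividing \<open>g m\<close> by an element of
    \<open>B\<close> either returns \<open>m\<close> or leaves \<open>M\<close>.\<close>
  have outside: "m = g m \<otimes> inv b'" if "m \<in> M" "b' \<in> B" "g m \<otimes> inv b' \<in> M" for m b'
    using uniq[of m "g m \<otimes> inv b'" b'] that gG BG by (auto simp: g_def m_assoc)

  \<comment> \<open>\<open>K\<close> may be infinite, so each coset in \<open>X\<close> is replaced
    by a finite sample. Its size exceeds the \<open>e\<close> elements of \<open>E\<close> and the
    at most \<open>2 * n * e\<close> elements that \<open>g\<close> sends into \<open>ES\<close>,
    with a margin for the pigeonhole count.\<close>
  have "\<exists>Q\<subseteq>R. card Q = 2 * (n + 1) * e + 1 \<and> finite Q" if "R \<in> X" for R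
  proof -
    have "card R = card K" using that X K K.subset by (metis card_rcosets_equal subsetD)
    moreover have "finite R \<longleftrightarrow> finite K"
      using that X K.subset by (metis card_cosets_equal bij_betw_finite subsetD)
    ultimately have "infinite R \<or> 2 * (n + 1) * e + 1 \<le> card R"
      using cK by (auto simp: n_def e_def)
    then show ?thesis by (meson exists_subset_card)
  qed
  then obtain Q where Q: "\<And>R. R \<in> X \<Longrightarrow> Q R \<subseteq> R" "\<And>R. R \<in> X \<Longrightarrow> card (Q R) = 2 * (n + 1) * e + 1"
      "\<And>R. R \<in> X \<Longrightarrow> finite (Q R)"
    by metis
  define ES where "ES = (\<lambda>(x, y). x \<otimes> y) ` (E \<times> S)"
  have finES: "finite ES" using E finS by (simp add: ES_def)
  have "card ES \<le> card E * card S" unfolding ES_def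
    using E finS by (metis card_cartesian_product card_image_le finite_cartesian_product)
  also have "\<dots> \<le> 2 * n * e" using cS by (simp add: e_def mult.commute)
  finally have cES: "card ES \<le> 2 * n * e" .
  \<comment> \<open>Excluding \<open>E\<close> places \<open>P\<close> inside \<open>M\<close>,
    where \<open>b m\<close> is controlled; excluding \<open>ES\<close> keeps the quotient
    \<open>z\<close> below out of \<open>E\<close>.\<close>
  define P where "P = {m \<in> \<Union>(Q ` X). m \<notin> E \<and> g m \<notin> ES}"
  have finP: "finite P" using X Q by (simp add: P_def)
  have PX: "m \<in> \<Union>X" if "m \<in> P" for m using that Q by (auto simp: P_def)
  have PM: "m \<in> M" if "m \<in> P" for m using that PX[OF that] E by (auto simp: P_def)
  \<comment> \<open>The colour of \<open>m\<close> is its own coset of \<open>K\<close>; its target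
    \<open>d m\<close> is the coset of \<open>g m\<close>.\<close>
  define c where "c m = K #> m" for m
  have cR: "c m = R" if "m \<in> R" "R \<in> X" for m R
  proof -
    have "R \<in> rcosets K" using that(2) X(2) by blast
    then obtain a where a: "a \<in> carrier G" "R = K #> a" unfolding RCOSETS_def by blast
    show ?thesis unfolding c_def using repr_independence[OF _ a(1) K, of m] that(1) a(2) by simp
  qed
  define d where "d m = K #> g m" for m
  define Y where "Y = (\<lambda>(R, y). R #> y) ` (T \<times> S)"
  have finY: "finite Y" using T finS by (simp add: Y_def)
  have "card Y \<le> card T * card S" unfolding Y_def
    using T finS by (metis card_cartesian_product card_image_le finite_cartesian_product)
  also have "\<dots> \<le> 2 * n * card T" using cS by (simp add: mult.commute)
  also have "\<dots> < card X" using less by (simp add: n_def)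
  finally have YX: "card Y < card X" .
  have dY: "d ` P \<subseteq> Y"
  proof
    fix y assume "y \<in> d ` P"
    then obtain m where m: "m \<in> P" "y = d m" by auto
    have mM: "m \<in> M" using PM m by auto
    define D where "D = H #> g m"
    have D: "D \<in> rcosets H" using gG[OF mM] by (auto simp: D_def RCOSETS_def)
    \<comment> \<open>As \<open>b'\<close> lies in the same right coset of \<open>H\<close> as
      \<open>g m\<close>, the quotient \<open>z\<close> lies in \<open>H\<close>. It avoids
      \<open>M\<close> because \<open>b'\<close> differs from \<open>b m\<close>, and hence falls
      into a coset from \<open>T\<close>.\<close>
    obtain b' where b': "b' \<in> s D" "b' \<noteq> b m"
    proof -
      have "\<not> s D \<subseteq> {b m}" using s[OF D] card_mono[of "{b m}" "s D"] by auto
      then show ?thesis using that by auto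
    qed
    have bS: "b' \<in> S" and b'B: "b' \<in> B" and b'D: "b' \<in> D" using b' D s[OF D] by (auto simp: S_def)
    have b'G: "b' \<in> carrier G" using b'B BG by auto
    define z where "z = g m \<otimes> inv b'"
    have gz: "g m = z \<otimes> b'" using gG[OF mM] b'G by (simp add: z_def m_assoc)
    have zG: "z \<in> carrier G" using gG[OF mM] b'G by (simp add: z_def)
    have "z \<in> H"
    proof -
      obtain h where h: "h \<in> H" "b' = h \<otimes> g m" using b'D by (auto simp: D_def r_coset_def)
      then have "z = inv h" using gG[OF mM]
        by (simp add: z_def inv_mult_group m_assoc[symmetric])
      then show ?thesis using h by simp
    qed
    moreover have "z \<notin> M"
    proof
      assume "z \<in> M"
      then have "m = z" using outside[OF mM b'B] by (simp add: z_def)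
      then have "m \<otimes> b' = m \<otimes> b m" using gz by (simp add: g_def)
      then show False using b'(2) mM MG BG bB[OF mM] b'G by (auto simp: subset_iff)
    qed
    moreover have "z \<notin> E"
      using gz m bS by (force simp: P_def ES_def)
    ultimately obtain R where R: "R \<in> T" "z \<in> R" using E(4) by blast
    have "R \<in> rcosets K" using R(1) T(2) by blast
    then obtain a where a: "a \<in> carrier G" "R = K #> a" unfolding RCOSETS_def by blast
    then have "R = K #> z" using repr_independence[OF _ a(1) K, of z] R(2) by simp
    then have "d m = R #> b'" using zG b'G K.subset by (simp add: d_def gz coset_mult_assoc)
    then show "y \<in> Y" using R bS m by (auto simp: Y_def)
  qed
  have few: "card {m \<in> P. d m = d m' \<and> c m \<noteq> c m'} \<le> e" if m': "m' \<in> P" for m'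
  proof -
    have m'M: "m' \<in> M" using PM m' by auto
    have bG: "b m' \<in> carrier G" using bB[OF m'M] BG by auto
    \<comment> \<open>With \<open>g m = k \<otimes> g m'\<close>, the element
      \<open>k \<otimes> m'\<close> has the colour of \<open>m'\<close> and so is not
      \<open>m\<close>. Then \<open>outside\<close> expels it from \<open>M\<close>, leaving only
      \<open>E\<close>.\<close>
    have "g m \<in> (\<lambda>x. x \<otimes> b m') ` E" if m: "m \<in> P" "d m = d m'" "c m \<noteq> c m'" for m
    proof -
      have mM: "m \<in> M" using PM m by auto
      have "g m \<in> K #> g m'" using m(2) gG[OF mM] K by (metis d_def rcos_self)
      then obtain k where k: "k \<in> K" "g m = k \<otimes> g m'" by (auto simp: r_coset_def)
      have z: "g m \<otimes> inv (b m') = k \<otimes> m'" using k m'M MG bG K.mem_carrier[OF k(1)]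
        by (auto simp: g_def m_assoc subset_iff)
      obtain R where R: "R \<in> X" "m' \<in> R" using PX[OF m'] by auto
      have "k \<otimes> m' \<in> R" using cR[OF R(2,1)] k by (auto simp: c_def r_coset_def)
      then have "c (k \<otimes> m') = c m'" using cR R by metis
      then have "k \<otimes> m' \<noteq> m" using m(3) by auto
      then have "k \<otimes> m' \<notin> M" using outside[OF mM bB[OF m'M]] z by auto
      then have "k \<otimes> m' \<in> E" using \<open>k \<otimes> m' \<in> R\<close> R E(3) by auto
      moreover have "g m = k \<otimes> m' \<otimes> b m'" using z gG[OF mM] bG
        by (metis inv_closed inv_solve_right' m_closed z r_inv m_assoc r_one l_inv)
      ultimately show ?thesis by auto
    qed
    then have gE: "g ` {m \<in> P. d m = d m' \<and> c m \<noteq> c m'} \<subseteq> (\<lambda>x. x \<otimes> b m') ` E" by blast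
    have inj: "inj_on g {m \<in> P. d m = d m' \<and> c m \<noteq> c m'}"
      using inj_g PM by (auto intro: inj_on_subset)
    have "card {m \<in> P. d m = d m' \<and> c m \<noteq> c m'} \<le> card ((\<lambda>x. x \<otimes> b m') ` E)"
      unfolding card_image[OF inj, symmetric] using E(1) gE by (intro card_mono) auto
    also have "\<dots> \<le> e" unfolding e_def using E(1) by (rule card_image_le)
    finally show ?thesis .
  qed
  \<comment> \<open>The losses to \<open>E\<close> and \<open>W\<close> are bounded once for all of
    \<open>Z\<close>, not once per coset, so a single sample of this size already outweighs
    them.\<close>
  have many: "2 * e * card Z < card {m \<in> P. c m \<in> Z} + 2 * e" if Z: "Z \<subseteq> X" "Z \<noteq> {}" for Z
  proof -
    have finZ: "finite Z" using Z X finite_subset by blast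
    have "card (\<Union>(Q ` Z)) = (\<Sum>R\<in>Z. card (Q R))"
    proof (rule card_UN_disjoint[OF finZ])
      show "\<forall>R\<in>Z. finite (Q R)" using Q Z by auto
      show "\<forall>R\<in>Z. \<forall>R'\<in>Z. R \<noteq> R' \<longrightarrow> Q R \<inter> Q R' = {}"
        using Q(1) cR Z by (metis disjoint_iff subset_iff)
    qed
    also have "\<dots> = card Z * (2 * (n + 1) * e + 1)" using Q Z by (simp add: subset_iff)
    finally have cQ: "card (\<Union>(Q ` Z)) = card Z * (2 * (n + 1) * e + 1)" .
    define W where "W = {m \<in> M. g m \<in> ES}"
    have gW: "g ` W \<subseteq> ES" "inj_on g W" using inj_g by (auto simp: W_def intro: inj_on_subset)
    then have "card W \<le> card ES" using finES by (metis card_image card_mono)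
    then have cW: "card W \<le> 2 * n * e" using cES by simp
    have finW: "finite W" using gW finES by (meson finite_imageD finite_subset)
    have "\<Union>(Q ` Z) \<subseteq> {m \<in> P. c m \<in> Z} \<union> (E \<union> W)"
    proof
      fix m assume "m \<in> \<Union>(Q ` Z)"
      then obtain R where R: "R \<in> Z" "m \<in> Q R" by auto
      then have "R \<in> X" "m \<in> R" using Z Q by auto
      then have "c m \<in> Z" "m \<in> M \<or> m \<in> E" using cR R E(3) by auto
      then show "m \<in> {m \<in> P. c m \<in> Z} \<union> (E \<union> W)" using R \<open>R \<in> X\<close> by (auto simp: P_def W_def)
    qed
    then have "card (\<Union>(Q ` Z)) \<le> card ({m \<in> P. c m \<in> Z} \<union> (E \<union> W))"
      using finP finW E(1) by (intro card_mono) auto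
    also have "\<dots> \<le> card {m \<in> P. c m \<in> Z} + (e + 2 * n * e)"
      using card_Un_le[of "{m \<in> P. c m \<in> Z}" "E \<union> W"] card_Un_le[of E W] cW unfolding e_def by linarith
    finally have le: "card Z * (2 * (n + 1) * e + 1) \<le> card {m \<in> P. c m \<in> Z} + (e + 2 * n * e)"
      using cQ by simp
    have "card Z > 0" using finZ Z by (simp add: card_gt_0_iff)
    then obtain k where k: "card Z = Suc k" using gr0_implies_Suc by blast
    show ?thesis using le unfolding k by (simp add: algebra_simps)
  qed
  show False
    by (rule colour_target_pigeonhole[OF X(1) finY finP dY YX few many])
qed

section \<open>Exchanging sides by inversion\<close>

text \<open>Inversion reverses products, and being an involution it carries a smaller left
  complement back to a smaller right complement.\<close>

lemma minimal_right_complement_inv: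
  assumes "minimal_right_complement G M B"
  shows "minimal_left_complement G (m_inv G ` M) (m_inv G ` B)"
proof -
  have inv_inv: "m_inv G ` m_inv G ` A = A" if "A \<subseteq> carrier G" for A
    using that by (force simp: image_iff subset_iff)
  have inv_carrier: "m_inv G ` carrier G = carrier G"
    by (intro equalityI subsetI) (auto intro!: image_eqI[where x = "inv x" for x])
  have inv_mult: "(m_inv G ` A) <#> (m_inv G ` A') = m_inv G ` (A' <#> A)"
    if "A \<subseteq> carrier G" "A' \<subseteq> carrier G" for A A'
    using that by (fastforce simp: set_mult_def image_iff inv_mult_group subset_iff)
  have left: "left_complement G (m_inv G ` A) (m_inv G ` B)" if "right_complement G A B" for A
    using that inv_carrier by (auto simp: left_complement_def right_complement_def inv_mult)
  have right: "right_complement G (m_inv G ` A) B" if "left_complement G A (m_inv G ` B)" for A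
  proof -
    have "A \<subseteq> carrier G" "A \<noteq> {}" "A <#> (m_inv G ` B) = carrier G"
      using that by (auto simp: left_complement_def)
    moreover have "B \<subseteq> carrier G" "B \<noteq> {}"
      using assms by (auto simp: minimal_right_complement_def right_complement_def)
    moreover have "m_inv G ` B \<subseteq> carrier G" using calculation by auto
    ultimately have "B <#> m_inv G ` A = carrier G"
      using inv_mult[of "m_inv G ` B" A] inv_inv[of B] inv_carrier by auto
    with \<open>A \<subseteq> carrier G\<close> \<open>A \<noteq> {}\<close> \<open>B \<subseteq> carrier G\<close> \<open>B \<noteq> {}\<close> show ?thesis
      by (auto simp: right_complement_def)
  qed
  have M: "right_complement G M B" "\<And>A. A \<subset> M \<Longrightarrow> \<not> right_complement G A B"
    using assms by (auto simp: minimal_right_complement_def)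
  then have MG: "M \<subseteq> carrier G" by (simp add: right_complement_def)
  have "\<not> left_complement G A (m_inv G ` B)" if "A \<subset> m_inv G ` M" for A
  proof
    assume lc: "left_complement G A (m_inv G ` B)"
    have "m_inv G ` A \<subseteq> M" using that MG inv_inv[of M] by blast
    moreover have "m_inv G ` A \<noteq> M"
      using that lc inv_inv[of A] by (auto simp: left_complement_def)
    ultimately show False using M(2) right[OF lc] by blast
  qed
  with left[OF M(1)] show ?thesis by (simp add: minimal_left_complement_def)
qed

end

section \<open>Choice of cosets and the two cases\<close>

theorem theorem2p2:
  fixes G :: "('a, 'b) monoid_scheme" and H K C E F :: "'a set"
  assumes "group G"
    and "subgroup H G"
    and "finite (rcosets\<^bsub>G\<^esub> H)"
    and "K \<lhd> (G\<lparr>carrier := H\<rparr>)"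
    and "C \<subset> H"
    and "\<exists>S \<subseteq> rcosets_in G H K. C = \<Union>S"
    and "\<exists>T \<subseteq> rcosets_in G H K. finite T \<and> H - C = \<Union>T"
    and "ecard {R \<in> rcosets_in G H K. R \<subseteq> C}
           > 2 * enat (subgroup_index G H) * ecard {R \<in> rcosets_in G H K. R \<subseteq> H - C}"
    and "finite E" and "E \<subseteq> C"
    and "F \<subseteq> H - C"
    and "\<exists>R \<in> rcosets_in G H K. R \<subseteq> H - C \<and> R \<inter> F = {}"
    and "ecard K > enat (2 * (subgroup_index G H + 1) * card E)"
  shows "\<not> minimal_complement G ((C - E) \<union> F)"
proof -
  interpret group G by fact
  interpret H: subgroup H G by fact
  interpret N: normal K "G\<lparr>carrier := H\<rparr>" by fact
  define M where "M = (C - E) \<union> F"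
  have K: "subgroup K G"
    using N.subgroup_axioms \<open>subgroup H G\<close> incl_subgroup by blast
  have rc: "rcosets_in G H K = (\<lambda>x. K #>\<^bsub>G\<^esub> x) ` H"
    by (auto simp: RCOSETS_def r_coset_def)
  have rcG: "rcosets_in G H K \<subseteq> rcosets\<^bsub>G\<^esub> K"
    unfolding rc using H.subset by (auto simp: RCOSETS_def)
  have self: "x \<in> K #>\<^bsub>G\<^esub> x" if "x \<in> H" for x using that K by (simp add: rcos_self)
  define T where "T = {R \<in> rcosets_in G H K. R \<subseteq> H - C}"
  obtain T' where T': "T' \<subseteq> rcosets_in G H K" "finite T'" "H - C = \<Union>T'" using assms(7) by blast
  \<comment> \<open>Right cosets of \<open>K\<close> are equal or disjoint, so any family with union
    \<open>H - C\<close> contains every coset inside \<open>H - C\<close>. This makes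
    \<open>T\<close> finite.\<close>
  have "T \<subseteq> T'"
  proof
    fix R assume R: "R \<in> T"
    then obtain x where x: "x \<in> H" "R = K #>\<^bsub>G\<^esub> x" by (auto simp: T_def rc)
    then have "x \<in> H - C" using self R by (auto simp: T_def)
    then obtain R' where R': "R' \<in> T'" "x \<in> R'" using T' by auto
    then obtain y where "y \<in> H" "R' = K #>\<^bsub>G\<^esub> y" using T' by (auto simp: rc)
    then have "R' = R" using R' x K by (metis H.mem_carrier repr_independence)
    then show "R \<in> T'" using R' by simp
  qed
  then have finT: "finite T" using T' finite_subset by blast
  have HC: "H - C \<subseteq> \<Union>T" using T' by (auto simp: T_def)
  have Trc: "T \<subseteq> rcosets_in G H K" by (auto simp: T_def)
  \<comment> \<open>The least size strictly above the bound. Exactly \<open>l\<close> cosets are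
    selected, as \<open>C\<close> may contain infinitely many.\<close>
  define l where "l = 2 * subgroup_index G H * card T + 1"
  have "enat (l - 1) < ecard {R \<in> rcosets_in G H K. R \<subseteq> C}"
    using assms(8) finT by (simp add: T_def[symmetric] ecard_def l_def numeral_eq_enat)
  then have "infinite {R \<in> rcosets_in G H K. R \<subseteq> C} \<or> l \<le> card {R \<in> rcosets_in G H K. R \<subseteq> C}"
    by (auto simp: ecard_def l_def split: if_splits)
  then obtain X where X: "X \<subseteq> {R \<in> rcosets_in G H K. R \<subseteq> C}" "card X = l" "finite X"
    by (meson exists_subset_card)
  have XH: "\<Union>X \<subseteq> C" and Xrc: "X \<subseteq> rcosets_in G H K" using X by auto
  have cK: "infinite K \<or> 2 * (card (rcosets\<^bsub>G\<^esub> H) + 1) * card E < card K"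
    using assms(13) by (auto simp: ecard_def split: if_splits)
  \<comment> \<open>Properness comes from the coset in \<open>H - C\<close> that misses
    \<open>F\<close>.\<close>
  have MH: "M \<subset> H"
  proof -
    obtain R where R: "R \<in> rcosets_in G H K" "R \<subseteq> H - C" "R \<inter> F = {}" using assms(12) by blast
    then obtain x where "x \<in> H" "R = K #>\<^bsub>G\<^esub> x" by (auto simp: rc)
    then have "x \<in> H - M" using R self[of x] by (auto simp: M_def)
    then show ?thesis using assms(5,11) by (auto simp: M_def)
  qed
  have XM: "\<Union>X - M \<subseteq> E" and HM: "H - M \<subseteq> \<Union>T \<union> E" using XH HC by (auto simp: M_def)
  have EH: "E \<subseteq> H" and EG: "E \<subseteq> carrier G" using assms(5,10) H.subset by auto
  have "\<not> minimal_left_complement G M B" for B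
    using assms(5) XH X(2) finT
    by (intro not_minimal_left_complement[OF assms(2,3) K MH X(3) _ finT _ assms(9) EG XM HM _ _ cK])
      (use rcG Trc Xrc in \<open>auto simp: l_def\<close>)
  moreover have "\<not> minimal_right_complement G M B" for B
  proof
    assume "minimal_right_complement G M B"
    then have "minimal_left_complement G (m_inv G ` M) (m_inv G ` B)"
      by (rule minimal_right_complement_inv)
    moreover have "\<not> minimal_left_complement G (m_inv G ` M) (m_inv G ` B)"
    proof (rule not_minimal_left_complement[OF assms(2,3) K])
      have inj: "inj_on (m_inv G) H" by (rule inj_onI) (metis H.mem_carrier inv_inv)
      have invH: "m_inv G ` H = H"
        by (intro equalityI subsetI) (auto intro!: image_eqI[where x = "inv\<^bsub>G\<^esub> x" for x])
      \<comment> \<open>Normality of \<open>K\<close> in \<open>H\<close> enters here: the inverse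
        of \<open>K x\<close> is a left coset, which is again a right coset. Inverses in
        \<open>H\<close> and in \<open>G\<close> agree.\<close>
      have inv_rc: "m_inv G ` R \<in> rcosets_in G H K" if "R \<in> rcosets_in G H K" for R
      proof -
        have "R \<subseteq> H"
          using that N.subset by (auto simp: rc r_coset_def)
        then have "set_inv\<^bsub>G\<lparr>carrier := H\<rparr>\<^esub> R = m_inv G ` R"
          using assms(2) by (auto simp: SET_INV_def m_inv_consistent subset_iff)
        then show ?thesis using N.setinv_closed[OF that] by simp
      qed
      have sub: "A \<subseteq> Pow H" if "A \<subseteq> rcosets_in G H K" for A
        using that N.subset by (fastforce simp: rc r_coset_def)
      have diff: "m_inv G ` (A - A') = m_inv G ` A - m_inv G ` A'" if "A \<subseteq> H" "A' \<subseteq> H" for A A'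
        using inj_on_image_set_diff[OF inj] that by (simp add: Diff_subset subset_iff)
      show "m_inv G ` M \<subset> H"
        using MH inj_on_image_eq_iff[OF inj, of M H] image_mono[of M H "m_inv G"] invH by auto
      show "finite ((`) (m_inv G) ` X)" "finite ((`) (m_inv G) ` T)" "finite (m_inv G ` E)"
        using X finT assms(9) by auto
      show "(`) (m_inv G) ` X \<subseteq> rcosets\<^bsub>G\<^esub> K" "(`) (m_inv G) ` T \<subseteq> rcosets\<^bsub>G\<^esub> K"
        using inv_rc Xrc Trc rcG by blast+
      show "m_inv G ` E \<subseteq> carrier G" using EG by auto
      have "\<Union>((`) (m_inv G) ` X) - m_inv G ` M = m_inv G ` (\<Union>X - M)"
        using diff[of "\<Union>X" M] XH MH assms(5) by (simp add: image_Union psubset_imp_subset)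
      then show "\<Union>((`) (m_inv G) ` X) - m_inv G ` M \<subseteq> m_inv G ` E"
        using XM by (simp add: image_mono)
      have "H - m_inv G ` M = m_inv G ` (H - M)" using diff[of H M] MH invH by simp
      then show "H - m_inv G ` M \<subseteq> \<Union>((`) (m_inv G) ` T) \<union> m_inv G ` E"
        using HM image_mono[OF HM, of "m_inv G"] by (simp add: image_Un image_Union)
      show "\<Union>((`) (m_inv G) ` X) \<subseteq> H"
        using XH assms(5) invH by (metis image_Union image_mono order_trans psubset_imp_subset)
      \<comment> \<open>The strict bound needs the image of \<open>X\<close> to keep its full size,
        which follows from injectivity on subsets of \<open>H\<close>; for \<open>T\<close> an upper
        bound suffices.\<close>
      have "card ((`) (m_inv G) ` X) = card X"
        using inj_on_image_Pow[OF inj] sub[OF Xrc] by (metis card_image inj_on_subset)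
      moreover have "card ((`) (m_inv G) ` T) \<le> card T" using finT by (rule card_image_le)
      then have "2 * card (rcosets\<^bsub>G\<^esub> H) * card ((`) (m_inv G) ` T) < l"
        by (simp add: l_def less_Suc_eq_le)
      ultimately show "2 * card (rcosets\<^bsub>G\<^esub> H) * card ((`) (m_inv G) ` T) < card ((`) (m_inv G) ` X)"
        using X(2) by simp
      have "card (m_inv G ` E) = card E" using inj EH by (metis card_image inj_on_subset)
      then show "infinite K \<or> 2 * (card (rcosets\<^bsub>G\<^esub> H) + 1) * card (m_inv G ` E) < card K"
        using cK by simp
    qed
    ultimately show False by contradiction
  qed
  ultimately show ?thesis by (auto simp: minimal_complement_def M_def)
qed

end
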